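(* For a nonzero integer $n$ let $B_n=\sup\{|S\cap(n^2,|n|^3)| : S \text{ has the property } D(n)\}$, where $(n^2,|n|^3)$ is the open interval. For all nonzero integers $n$, $B_n<0.6114\,\log|n|+2.158$. If $|n|>400$, then $B_n<0.6071\,\log|n|+2.152$.
   Context: For a nonzero integer $n$, a set of $m$ (distinct) positive integers $S=\{a_1,a_2,\ldots,a_m\}$ is said to have the property $D(n)$ if $a_ia_j+n$ is a perfect square (the square of an integer, $0$ allowed) for all $1\leq i<j\leq m$. The supremum defining $B_n$ is over all sets $S$ of positive integers with the property $D(n)$, of any size $m$. Here $\log$ denotes the natural logarithm. For $|n|=1$ the interval $(n^2,|n|^3)$ is empty. *)

theory Defs
  imports Complex_Main "HOL-Computational_Algebra.Nth_Powers"
begin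

definition property_D :: "int \<Rightarrow> int set \<Rightarrow> bool" where
  "property_D n S \<longleftrightarrow>
     finite S \<and> (\<forall>a\<in>S. 0 < a) \<and> (\<forall>a\<in>S. \<forall>b\<in>S. a \<noteq> b \<longrightarrow> is_square (a * b + n))"

(* The supremum is taken in nat; B_D_attained below shows that it is a genuine maximum. *)
definition B_D :: "int \<Rightarrow> nat" where
  "B_D n = (SUP S\<in>{S. property_D n S}. card (S \<inter> {n\<^sup>2<..<\<bar>n\<bar> ^ 3}))"

lemma B_D_bdd_above:
  "bdd_above ((\<lambda>S. card (S \<inter> {n\<^sup>2<..<\<bar>n\<bar> ^ 3})) ` {S. property_D n S})"
  by (rule bdd_aboveI2[where M = "card {n\<^sup>2<..<\<bar>n\<bar> ^ 3}"]) (rule card_mono; simp)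

lemma property_D_empty: "property_D n {}"
  by (simp add: property_D_def)

lemma B_D_attained:
  "\<exists>S. property_D n S \<and> card (S \<inter> {n\<^sup>2<..<\<bar>n\<bar> ^ 3}) = B_D n"
proof -
  let ?f = "\<lambda>S. card (S \<inter> {n\<^sup>2<..<\<bar>n\<bar> ^ 3})"
  have "?f ` {S. property_D n S} \<noteq> {}"
    using property_D_empty by blast
  then have "Sup (?f ` {S. property_D n S}) \<in> ?f ` {S. property_D n S}"
    using B_D_bdd_above[of n] by (metis Sup_nat_def bdd_above_nat Max_in)
  then show ?thesis
    by (auto simp: B_D_def)
qed

lemma card_le_B_D: "property_D n S \<Longrightarrow> card (S \<inter> {n\<^sup>2<..<\<bar>n\<bar> ^ 3}) \<le> B_D n"
  unfolding B_D_def by (rule cSUP_upper) (use B_D_bdd_above in auto)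

end

(* For a D(n)-triple n^2 < a < b < c with square roots r, s, t of ab+n, ac+n, bc+n, put
   e = n(a+b+c) + 2abc - 2rst, x = at - rs, y = bs - rt.  Then ae + n^2 = x^2, be + n^2 = y^2
   and n^2 (c-a-b) = ne + 2(abe + rxy).  As a > n^2, the first equation gives e >= 0.  If e = 0,
   then c = a+b+2r; if e >= 1, then n^2 c > n^2 (a+b) + 4ab,
   since x and y both have the sign opposite to that of n and hence xy > 0.  The first alternative cannot hold
   for the three largest elements of a quadruple.  So, in units of n^2, the elements of the set
   exceed 1, 1, 4, 21 and from there on grow at least by a factor 10 at each step,
   whereas they are bounded by |n|. *)
theory Submission
  imports Defs "HOL-Analysis.Complex_Transcendental"
begin

section \<open>Gaps in a single triple\<close>

lemma abs_le_square_int: "\<bar>n :: int\<bar> \<le> n\<^sup>2"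
  using self_le_power[of "\<bar>n\<bar>" 2] by (cases "n = 0") auto

lemma is_square_nonneg_root:
  fixes k :: int
  assumes "is_square k"
  obtains r where "0 \<le> r" "r\<^sup>2 = k"
  using assms by (metis is_nth_power_def power2_abs abs_ge_zero)

lemma diophantine_triple_gap:
  fixes n a b c r s t :: int
  assumes n: "n \<noteq> 0" and a: "n\<^sup>2 < a" and ab: "a < b" and bc: "b < c"
    and r0: "0 \<le> r" and s0: "0 \<le> s" and t0: "0 \<le> t"
    and r: "r\<^sup>2 = a * b + n" and s: "s\<^sup>2 = a * c + n" and t: "t\<^sup>2 = b * c + n"
  shows "c = a + b + 2 * r \<or> n\<^sup>2 * c > n\<^sup>2 * (a + b) + 4 * (a * b)"
proof -
  define e x y where "e = n * (a + b + c) + 2 * (a * b * c) - 2 * (r * s * t)"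
    and "x = a * t - r * s" and "y = b * s - r * t"
  have N1: "1 \<le> \<bar>n\<bar>" using n by linarith
  have Nsq: "\<bar>n\<bar> \<le> n\<^sup>2"
    by (rule abs_le_square_int)
  have a0: "0 < a" and b0: "0 < b" and c0: "0 < c" and aN: "\<bar>n\<bar> < a" and bN: "\<bar>n\<bar> < b"
    using a ab bc Nsq N1 by linarith+
  have xx: "x\<^sup>2 = a * e + n\<^sup>2" using r s t unfolding e_def x_def by algebra
  have yy: "y\<^sup>2 = b * e + n\<^sup>2" using r s t unfolding e_def y_def by algebra
  have key: "n\<^sup>2 * (c - a - b) = n * e + 2 * (a * b * e + r * (x * y))"
    using r s t unfolding e_def x_def y_def by algebra
  \<comment> \<open>A square is nonnegative, so a e >= -n^2 > -a, which leaves only e > -1.\<close>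
  have "- a < a * e" using xx a zero_le_power2[of x] by linarith
  then have "a * (-1) < a * e" by simp
  then have e0: "0 \<le> e" using a0 by (simp only: mult_less_cancel_left_pos)
  \<comment> \<open>The left-hand side is x (at + rs), so its sign decides that of x; likewise below
    for y. The brackets on the right are positive because b + c - a and a + c - b are at least 1 and
    a, b exceed |n|.\<close>
  have xd: "(a * t)\<^sup>2 - (r * s)\<^sup>2 = - n * (a * (b + c - a) + n)"
    using r s t by algebra
  have yd: "(b * s)\<^sup>2 - (r * t)\<^sup>2 = - n * (b * (a + c - b) + n)"
    using r s t by algebra
  have "a * 1 \<le> a * (b + c - a)" using ab bc a0 c0 by (intro mult_left_mono) auto
  then have xp: "0 < a * (b + c - a) + n" using aN by linarith
  have "b * 1 \<le> b * (a + c - b)" using ab bc a0 c0 b0 by (intro mult_left_mono) auto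
  then have yp: "0 < b * (a + c - b) + n" using bN by linarith
  have xy: "0 < x * y \<and> sgn x = - sgn n \<and> sgn y = - sgn n"
  proof (cases "0 < n")
    case True
    have "(a * t)\<^sup>2 < (r * s)\<^sup>2" using xd mult_pos_pos[OF True xp] by simp
    then have x: "x < 0" unfolding x_def using r0 s0 by (simp add: power2_less_imp_less)
    have "(b * s)\<^sup>2 < (r * t)\<^sup>2" using yd mult_pos_pos[OF True yp] by simp
    then have y: "y < 0" unfolding y_def using r0 t0 by (simp add: power2_less_imp_less)
    show ?thesis using x y True by (simp add: mult_neg_neg)
  next
    case False
    then have n: "n < 0" using n by simp
    have "(r * s)\<^sup>2 < (a * t)\<^sup>2" using xd mult_neg_pos[OF n xp] by simp
    then have x: "0 < x" unfolding x_def using a0 t0 by (simp add: power2_less_imp_less)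
    have "(r * t)\<^sup>2 < (b * s)\<^sup>2" using yd mult_neg_pos[OF n yp] by simp
    then have y: "0 < y" unfolding y_def using b0 s0 by (simp add: power2_less_imp_less)
    show ?thesis using x y n by simp
  qed
  show ?thesis
  proof (cases "e = 0")
    case True
    \<comment> \<open>Here x^2 = y^2 = n^2, and the signs leave only x = y = -n, so
      \<open>key\<close> collapses to c - a - b = 2r.\<close>
    have "x = - n" "y = - n"
      using xx yy True xy n by (auto simp: power2_eq_iff sgn_if split: if_splits)
    then have "n\<^sup>2 * (c - a - b) = n\<^sup>2 * (2 * r)"
      using key True by (simp add: power2_eq_square)
    then show ?thesis using n by simp
  next
    case False
    then have e1: "1 \<le> e" using e0 by linarith
    \<comment> \<open>The aim is r x y > P + |n|, obtained by comparing squares: r^2 >= P - |n| and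
      x^2 y^2 >= P + K.\<close>
    define P K where "P = a * b" and "K = n\<^sup>2 * (a + b)"
    have "n\<^sup>2 \<ge> 1" using N1 Nsq by linarith
    \<comment> \<open>A product of two consecutive integers is nonnegative. This gives b >= n^2 + 2
      >= 3|n|, and a >= 2 then yields P >= 6|n|.\<close>
    have q: "0 \<le> (\<bar>n\<bar> - 1) * (\<bar>n\<bar> - 2)"
      by (cases "\<bar>n\<bar> = 1") (use N1 in auto)
    then have q: "3 * \<bar>n\<bar> \<le> n\<^sup>2 + 2"
      by (simp add: algebra_simps power2_eq_square flip: abs_mult)
    have "2 * (3 * \<bar>n\<bar>) \<le> a * b" using a ab \<open>1 \<le> n\<^sup>2\<close> q by (intro mult_mono) auto
    then have P: "6 * \<bar>n\<bar> \<le> P" by (simp add: P_def)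
    have "\<bar>n\<bar> * 5 \<le> n\<^sup>2 * (a + b)" using a ab \<open>1 \<le> n\<^sup>2\<close> Nsq by (intro mult_mono) auto
    then have K: "5 * \<bar>n\<bar> \<le> K" by (simp add: K_def)
    \<comment> \<open>After expansion \<open>PK\<close> reads 3|n|P + |n|K + n^2 < KP. Three fifths
      of KP cover the first term, the other two fifths the rest.\<close>
    have "5 * \<bar>n\<bar> * P \<le> K * P" using K P N1 by (intro mult_right_mono) auto
    moreover have "K * (6 * \<bar>n\<bar>) \<le> K * P" using K P N1 by (intro mult_left_mono) auto
    moreover have "5 * \<bar>n\<bar> * \<bar>n\<bar> \<le> K * \<bar>n\<bar>" using K by (intro mult_right_mono) auto
    moreover have "0 < \<bar>n\<bar> * \<bar>n\<bar>" using N1 by (intro mult_pos_pos) linarith+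
    ultimately have PK: "(P + \<bar>n\<bar>)\<^sup>2 < (P - \<bar>n\<bar>) * (P + K)"
      unfolding power2_eq_square by (simp only: algebra_simps)
    have "a * 1 \<le> a * e" "b * 1 \<le> b * e" using e1 a0 b0 by (auto intro: mult_left_mono)
    then have "(a + n\<^sup>2) * (b + n\<^sup>2) \<le> x\<^sup>2 * y\<^sup>2"
      unfolding xx yy using a0 b0 e1 by (intro mult_mono) auto
    moreover have "P + K \<le> (a + n\<^sup>2) * (b + n\<^sup>2)"
      by (simp add: P_def K_def algebra_simps)
    ultimately have "P + K \<le> x\<^sup>2 * y\<^sup>2" by linarith
    then have "(P - \<bar>n\<bar>) * (P + K) \<le> r\<^sup>2 * (x\<^sup>2 * y\<^sup>2)"
      unfolding r using P K N1 by (intro mult_mono) (auto simp: P_def)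
    with PK have "(P + \<bar>n\<bar>)\<^sup>2 < (r * (x * y))\<^sup>2" by (simp add: power_mult_distrib)
    then have rxy: "P + \<bar>n\<bar> < r * (x * y)"
      by (rule power2_less_imp_less) (use r0 xy in simp)
    \<comment> \<open>For negative n the term n is absorbed by the surplus 2|n| coming from 2 r x
      y.\<close>
    have "(2 * P + n) * 1 \<le> (2 * P + n) * e"
      using e1 P N1 by (intro mult_left_mono) linarith+
    moreover have "n\<^sup>2 * (c - a - b) = (2 * P + n) * e + 2 * (r * (x * y))"
      unfolding key by (simp add: P_def algebra_simps)
    moreover have "- \<bar>n\<bar> \<le> n" by linarith
    ultimately have "4 * P < n\<^sup>2 * (c - a - b)"
      using rxy N1 unfolding mult_1_right by linarith
    then show ?thesis by (simp add: P_def algebra_simps)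
  qed
qed

section \<open>Growth inside a set with the property D(n)\<close>

lemma property_D_triple_cases:
  assumes "property_D n S" "n \<noteq> 0" "a \<in> S" "b \<in> S" "c \<in> S" "n\<^sup>2 < a" "a < b" "b < c"
  obtains r where "0 \<le> r" "r\<^sup>2 = a * b + n" "c = a + b + 2 * r"
  | "n\<^sup>2 * c > n\<^sup>2 * (a + b) + 4 * (a * b)"
proof -
  have "is_square (a * b + n)" "is_square (a * c + n)" "is_square (b * c + n)"
    using assms unfolding property_D_def by auto
  then obtain r s t where "0 \<le> r" "r\<^sup>2 = a * b + n" "0 \<le> s" "s\<^sup>2 = a * c + n"
    "0 \<le> t" "t\<^sup>2 = b * c + n"
    by (metis is_square_nonneg_root)
  then show ?thesis using diophantine_triple_gap[of n a b c r s t] assms that by blast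
qed

text \<open>In the first alternative r > a, hence c > 4a; in the second, n^2 c > 4ab > 4n^4.\<close>

lemma property_D_third_gt:
  assumes S: "property_D n S" "n \<noteq> 0" "a \<in> S" "b \<in> S" "c \<in> S" and ord: "n\<^sup>2 < a" "a < b" "b < c"
  shows "c > 4 * n\<^sup>2"
  using S ord
proof (cases rule: property_D_triple_cases)
  case (1 r)
  have "a * (a + 1) \<le> a * b" using ord by (intro mult_left_mono) (auto intro: order.trans[of 0 "n\<^sup>2"])
  then have "a\<^sup>2 < r\<^sup>2"
    using 1 ord abs_le_square_int[of n] by (simp add: algebra_simps power2_eq_square)
  then have "a < r" using 1 by (simp add: power2_less_imp_less)
  then show ?thesis using 1 ord by linarith
next
  case 2
  have "n\<^sup>2 * (4 * n\<^sup>2) \<le> 4 * (a * b)"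
    using mult_mono[of "n\<^sup>2" a "n\<^sup>2" b] ord by simp
  moreover have "0 \<le> n\<^sup>2 * (a + b)"
    using ord zero_le_power2[of n] by (intro mult_nonneg_nonneg) linarith+
  ultimately have "n\<^sup>2 * (4 * n\<^sup>2) < n\<^sup>2 * c" using 2 by linarith
  then show ?thesis using S(2) by simp
qed

text \<open>The smallest element a serves only to exclude d = b + c + 2t. That equation would give d
  <= b + 3c, whereas the triple (a, c, d) forces either d = a + c + 2s with s < t, which is too
  small, or d > a + 5c, which is too large.\<close>

lemma property_D_quadruple_gap:
  assumes S: "property_D n S" "n \<noteq> 0" "a \<in> S" "b \<in> S" "c \<in> S" "d \<in> S"
    and ord: "n\<^sup>2 < a" "a < b" "b < c" "c < d"
  shows "n\<^sup>2 * d > n\<^sup>2 * (b + c) + 4 * (b * c)"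
proof -
  have pos: "0 < a" "0 < b" "0 < c" using ord zero_le_power2[of n] by linarith+
  have nb: "n\<^sup>2 < b" and ac: "a < c" using ord by linarith+
  show ?thesis
    using S(1,2,4,5,6) nb ord(3,4)
  proof (cases rule: property_D_triple_cases)
    case (1 t)
    have "c * b \<le> c * (c - 1)" using ord pos by (intro mult_left_mono) auto
    then have "t\<^sup>2 \<le> c\<^sup>2"
      using 1 ord abs_le_square_int[of n] by (simp add: algebra_simps power2_eq_square)
    then have tc: "t \<le> c" by (rule power2_le_imp_le) (use pos in simp)
    show ?thesis
      using S(1,2,3,5,6) ord(1) ac ord(4)
    proof (cases rule: property_D_triple_cases)
      case s: (1 s)
      have "a * c < b * c" using ord pos by simp
      then have "s\<^sup>2 < t\<^sup>2" using s(2) 1(2) by linarith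
      then have "s < t" using 1(1) by (rule power2_less_imp_less)
      then show ?thesis using s(3) 1(3) ord by linarith
    next
      case 2
      have "n\<^sup>2 * (4 * c) \<le> 4 * (a * c)" using ord(1) pos by simp
      then have "n\<^sup>2 * (a + c + 4 * c) < n\<^sup>2 * d" using 2 by (simp add: algebra_simps)
      then have "a + c + 4 * c < d" using S(2) by simp
      then show ?thesis using 1(3) tc ord pos by linarith
    qed
  next
    case 2
    then show ?thesis .
  qed
qed

text \<open>The element \<open>f 0\<close> is the smallest member of every quadruple used. The
  constant 21 is 1 + 4 + 4 * 1 * 4, from \<open>f 1\<close> > n^2 and \<open>f 2\<close> > 4
  n^2.\<close>

lemma property_D_sequence_growth:
  fixes f :: "nat \<Rightarrow> int"
  assumes S: "property_D n S" "n \<noteq> 0"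
    and f: "\<And>i. i < m \<Longrightarrow> f i \<in> S" "\<And>i. i < m \<Longrightarrow> n\<^sup>2 < f i"
    and mono: "\<And>i j. i < j \<Longrightarrow> j < m \<Longrightarrow> f i < f j"
    and k: "k + 3 < m"
  shows "f (k + 3) > n\<^sup>2 * (21 * 10 ^ k)"
  using k
proof (induction k)
  case 0
  have 4: "4 * n\<^sup>2 < f 2"
    using property_D_third_gt[OF S, of "f 0" "f 1" "f 2"] f mono 0 by simp
  have 1: "n\<^sup>2 < f 1" using f 0 by simp
  have "n\<^sup>2 * (4 * n\<^sup>2) \<le> f 1 * f 2" using 1 4 order.trans[OF zero_le_power2 less_imp_le[OF 1]]
    by (intro mult_mono) auto
  moreover have "n\<^sup>2 * (5 * n\<^sup>2) \<le> n\<^sup>2 * (f 1 + f 2)" using 1 4 by (intro mult_left_mono) auto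
  moreover have "n\<^sup>2 * (f 1 + f 2) + 4 * (f 1 * f 2) < n\<^sup>2 * f 3"
    using property_D_quadruple_gap[OF S, of "f 0" "f 1" "f 2" "f 3"] f mono 0 by simp
  ultimately have "n\<^sup>2 * (21 * n\<^sup>2) < n\<^sup>2 * f 3" by linarith
  then have "21 * n\<^sup>2 < f 3" using S(2) by simp
  then show ?case by simp
next
  case (Suc k)
  have 4: "4 * n\<^sup>2 < f (k + 2)"
    using property_D_third_gt[OF S, of "f 0" "f 1" "f (k + 2)"] f mono Suc.prems by simp
  have fk: "0 < f (k + 3)" using f(2)[of "k + 3"] Suc.prems zero_le_power2[of n] by linarith
  have "4 * n\<^sup>2 * f (k + 3) \<le> f (k + 2) * f (k + 3)" using 4 fk by (intro mult_right_mono) auto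
  moreover have "n\<^sup>2 * (f (k + 2) + f (k + 3)) + 4 * (f (k + 2) * f (k + 3)) < n\<^sup>2 * f (k + 4)"
    using property_D_quadruple_gap[OF S, of "f 0" "f (k + 2)" "f (k + 3)" "f (k + 4)"] f mono Suc.prems
    by simp
  moreover have "0 \<le> n\<^sup>2 * (f (k + 2))" 
    using order.trans[OF _ less_imp_le[OF 4], of 0] by simp
  moreover have "0 \<le> n\<^sup>2 * f (k + 3)" using fk by simp
  \<comment> \<open>The estimates even give the factor 1 + 4 * 4 = 17; 10 suffices for the
    logarithmic bounds.\<close>
  ultimately have "n\<^sup>2 * (10 * f (k + 3)) < n\<^sup>2 * f (k + 4)"
    by (simp only: algebra_simps)
  then have "10 * f (k + 3) < f (k + 4)" using S(2) by simp
  then show ?case using Suc by (simp add: numeral_eq_Suc)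
qed

section \<open>Counting elements below |n|^3 and the logarithmic bounds\<close>

lemma property_D_card_bounds:
  assumes S: "property_D n S" and n: "n \<noteq> 0"
    and m: "m = card (S \<inter> {n\<^sup>2<..<\<bar>n\<bar> ^ 3})"
  shows "3 \<le> m \<Longrightarrow> 4 < \<bar>n\<bar>" and "k + 3 < m \<Longrightarrow> 21 * 10 ^ k < \<bar>n\<bar>"
proof -
  define T where "T = S \<inter> {n\<^sup>2<..<\<bar>n\<bar> ^ 3}"
  define f where "f = nth (sorted_list_of_set T)"
  have T: "finite T" using S by (simp add: T_def property_D_def)
  have len: "length (sorted_list_of_set T) = m" by (simp add: m T_def)
  have "f i \<in> T" if "i < m" for i
    using nth_mem[of i "sorted_list_of_set T"] that T len by (simp add: f_def)
  \<comment> \<open>Writing |n|^3 as n^2 |n| lets n^2 be cancelled against the lower bounds on the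
    elements.\<close>
  then have fS: "f i \<in> S" and lo: "n\<^sup>2 < f i" and hi: "f i < n\<^sup>2 * \<bar>n\<bar>" if "i < m" for i
    using that by (auto simp: T_def power2_eq_square power3_eq_cube simp flip: abs_mult)
  have mono: "f i < f j" if "i < j" "j < m" for i j
    using sorted_wrt_nth_less[OF strict_sorted_list_of_set, of i j T] that len by (simp add: f_def)
  show "4 < \<bar>n\<bar>" if "3 \<le> m"
  proof -
    have "4 * n\<^sup>2 < f 2"
      using property_D_third_gt[OF S n, of "f 0" "f 1" "f 2"] fS lo mono that by simp
    with hi[of 2] that have "n\<^sup>2 * 4 < n\<^sup>2 * \<bar>n\<bar>" by simp
    then show ?thesis using n by simp
  qed
  show "21 * 10 ^ k < \<bar>n\<bar>" if "k + 3 < m"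
  proof -
    have "n\<^sup>2 * (21 * 10 ^ k) < f (k + 3)"
      using property_D_sequence_growth[OF S n fS lo mono that] .
    with hi[OF that] have "n\<^sup>2 * (21 * 10 ^ k) < n\<^sup>2 * \<bar>n\<bar>" by linarith
    then show ?thesis using n by simp
  qed
qed

text \<open>Since e < 2.72, a comparison of rational powers certifies a lower bound for a
  logarithm.\<close>

lemma ln_gt_from_powers:
  fixes p q :: nat and x y :: real
  assumes "0 < q" "0 < x" "(272 / 100) ^ p < x ^ q"
  shows "real p / real q < ln x"
proof -
  have "exp (real p) = exp 1 ^ p" by (simp flip: exp_of_nat_mult)
  also have "\<dots> \<le> (272 / 100) ^ p" using e_less_272 by (intro power_mono) auto
  also have "\<dots> < x ^ q" by fact
  finally have "real p < ln (x ^ q)" using assms(2) by (subst exp_less_cancel_iff[symmetric]) simp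
  then show ?thesis using assms by (simp add: ln_realpow field_simps)
qed

theorem proposition2:
  fixes n :: int
  assumes "n \<noteq> 0"
  shows "real (B_D n) < 0.6114 * ln \<bar>real_of_int n\<bar> + 2.158 \<and>
         (\<bar>n\<bar> > 400 \<longrightarrow> real (B_D n) < 0.6071 * ln \<bar>real_of_int n\<bar> + 2.152)"
proof -
  define m L where "m = B_D n" and "L = ln \<bar>real_of_int n\<bar>"
  obtain S where S: "property_D n S" "m = card (S \<inter> {n\<^sup>2<..<\<bar>n\<bar> ^ 3})"
    using B_D_attained[of n] by (auto simp: m_def)
  note bounds = property_D_card_bounds[OF S(1) assms S(2)]
  have L0: "0 \<le> L" using assms by (simp add: L_def ln_ge_zero)
  have ln400: "real 5 / real 1 < L" if "400 < \<bar>n\<bar>"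
  proof -
    have "real 5 / real 1 < ln 400" by (rule ln_gt_from_powers) (auto simp: power_divide)
    also have "\<dots> < L" unfolding L_def using that by (subst ln_less_cancel_iff) auto
    finally show ?thesis .
  qed
  consider "m \<le> 2" | "m = 3" | k where "m = k + 4"
  proof -
    \<comment> \<open>For m >= 4 the truncated subtraction is exact; k counts the elements beyond
      the fourth.\<close>
    have "m \<le> 2 \<or> m = 3 \<or> m = m - 4 + 4" by linarith
    then show thesis using that by blast
  qed
  then have "real m < 0.6114 * L + 2.158 \<and> (\<bar>n\<bar> > 400 \<longrightarrow> real m < 0.6071 * L + 2.152)"
  proof cases
    case 1
    then show ?thesis using L0 by simp
  next
    case 2
    \<comment> \<open>Three elements force |n| >= 5, and 0.6114 * 1.4 + 2.158 is just above
      3.\<close>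
    have "real 7 / real 5 < ln 5" by (rule ln_gt_from_powers) (auto simp: power_divide)
    also have "ln 5 \<le> L" unfolding L_def using bounds(1) 2 by (subst ln_le_cancel_iff) auto
    finally show ?thesis using 2 ln400 by auto
  next
    case (3 k)
    have "21 * 10 ^ k < \<bar>n\<bar>" using bounds(2)[of k] 3 by simp
    then have "real_of_int (21 * 10 ^ k) < real_of_int \<bar>n\<bar>" by (simp only: of_int_less_iff)
    then have "ln (21 * 10 ^ k) < L"
      unfolding L_def using assms by (subst ln_less_cancel_iff) auto
    moreover have "ln (21 * 10 ^ k) = ln 21 + real k * ln (10 :: real)"
      by (simp add: ln_mult ln_realpow)
    moreover have "real 76 / real 25 < ln 21" by (rule ln_gt_from_powers) (auto simp: power_divide)
    moreover have "real 5 / real 3 < ln 10" by (rule ln_gt_from_powers) (auto simp: power_divide)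
    then have "real k * (5 / 3) \<le> real k * ln 10" by (intro mult_left_mono) auto
    ultimately have L: "76 / 25 + real k * (5 / 3) < L" by simp
    show ?thesis
    \<comment> \<open>At k = 0 the bound 76/25 on L gives 0.6114 L + 2.158 > 4 but falls just short
      for the second inequality, so \<open>ln400\<close> is needed there. For k >= 1 the surplus of
      0.6071 * 5/3 over 1 makes up the deficit.\<close>
    proof (cases "k = 0")
      case True
      then show ?thesis using L 3 ln400 by auto
    next
      case False
      then have "1 \<le> real k" by simp
      then show ?thesis using L 3 by simp
    qed
  qed
  then show ?thesis by (simp add: m_def L_def)
qed

end
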